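(* Let $I\subset\mathbb{R}$ be an interval, let $f:I\to\mathbb{R}$ be differentiable on the interior $I^{\circ}$ with $f'\in L[a,b]$, where $a,b\in I^{\circ}$, $a<b$. Let $q>1$ and let $p$ satisfy $\frac1p+\frac1q=1$. If $|f'|^{q}$ is quasi-convex on $[a,b]$, then $$\left|\frac16\left[f(a)+4f\left(\frac{a+b}{2}\right)+f(b)\right]-\frac{1}{b-a}\int_a^b f(x)\,dx\right|\le \frac{b-a}{6}\left(\frac{1+2^{p+1}}{3(p+1)}\right)^{1/p}\left(\sup\{|f'(a)|^q,|f'(b)|^q\}\right)^{1/q}.$$
   Context: A function $g:[a,b]\to\mathbb{R}$ is quasi-convex on $[a,b]$ if $g(tx+(1-t)y)\le\sup\{g(x),g(y)\}$ for all $x,y\in[a,b]$ and $t\in[0,1]$. $L[a,b]$ denotes the set of Lebesgue integrable functions on $[a,b]$. *)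

theory Defs
  imports "HOL-Analysis.Analysis"
begin

definition quasi_convex_on :: "real set \<Rightarrow> (real \<Rightarrow> real) \<Rightarrow> bool" where
  "quasi_convex_on S g \<longleftrightarrow>
     (\<forall>x\<in>S. \<forall>y\<in>S. \<forall>t\<in>{0..1}. g (t * x + (1 - t) * y) \<le> Sup {g x, g y})"

end

theory Submission
  imports Defs
begin

text \<open>
  Quasi-convexity bounds \<open>\<bar>f'\<bar>\<close> on \<open>[a, b]\<close> by its larger endpoint value \<open>M\<close>, so \<open>f\<close> is
  \<open>M\<close>-Lipschitz there. Comparing \<open>f\<close> with its values at \<open>a\<close>, \<open>(a + b) / 2\<close> and \<open>b\<close> on consecutive
  subintervals of relative lengths \<open>1/6\<close>, \<open>4/6\<close> and \<open>1/6\<close> (Ostrowski's inequality) bounds the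
  error by \<open>5/36 (b - a) M\<close>. Finally, Bernoulli's inequality for \<open>(6/5) powr p\<close> and
  \<open>(12/5) powr p\<close> shows that the constant in the claim is at least \<open>5/6\<close>.
\<close>

text \<open>The convex function \<open>\<lambda>x. x powr p\<close> lies above its tangent at 1,
  which has slope \<open>p\<close>.\<close>

lemma Bernoulli_inequality_powr:
  fixes x p :: real
  assumes "x > -1" "p \<ge> 1"
  shows "1 + p * x \<le> (1 + x) powr p"
proof -
  have "((\<lambda>x. x powr p) has_real_derivative p) (at 1 within {0<..})"
    by (auto intro!: derivative_eq_intros)
  then have "(1 + x) powr p - 1 powr p \<ge> p * ((1 + x) - 1)"
    using assms
    by (intro convex_on_imp_above_tangent[OF powr_convex])
       (auto simp: interior_open)
  then show ?thesis by simp
qed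

lemma has_integral_abs_diff:
  fixes c d e :: real
  assumes "c \<le> e" "e \<le> d"
  shows "((\<lambda>x. \<bar>x - e\<bar>) has_integral ((e - c)\<^sup>2 + (d - e)\<^sup>2) / 2) {c..d}"
proof -
  have "((\<lambda>x. e - x) has_integral (e * (e - c) - (e\<^sup>2 - c\<^sup>2) / 2)) {c..e}"
    using has_integral_const_real[of e c e] ident_has_integral[of c e] assms
    by (intro has_integral_diff) (auto simp: mult.commute)
  then have "((\<lambda>x. \<bar>x - e\<bar>) has_integral (e - c)\<^sup>2 / 2) {c..e}"
    by (rule has_integral_eq_rhs[OF has_integral_eq[rotated]])
       (auto simp: power2_eq_square field_simps)
  moreover have "((\<lambda>x. x - e) has_integral ((d\<^sup>2 - e\<^sup>2) / 2 - e * (d - e))) {e..d}"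
    using has_integral_const_real[of e e d] ident_has_integral[of e d] assms
    by (intro has_integral_diff) (auto simp: mult.commute)
  then have "((\<lambda>x. \<bar>x - e\<bar>) has_integral (d - e)\<^sup>2 / 2) {e..d}"
    by (rule has_integral_eq_rhs[OF has_integral_eq[rotated]])
       (auto simp: power2_eq_square field_simps)
  ultimately show ?thesis
    using has_integral_combine[OF assms] by (simp add: add_divide_distrib)
qed

text \<open>Integrate the pointwise bound
  \<open>\<bar>f x - f e\<bar> \<le> K * \<bar>x - e\<bar>\<close>. The sample point
  \<open>e\<close> may be an endpoint.\<close>

lemma Ostrowski_inequality:
  fixes f :: "real \<Rightarrow> real" and c d e K :: real
  assumes lip: "K-lipschitz_on {c..d} f" and ce: "c \<le> e" and ed: "e \<le> d"
  shows "\<bar>integral {c..d} f - (d - c) * f e\<bar> \<le> K * (((e - c)\<^sup>2 + (d - e)\<^sup>2) / 2)"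
proof -
  have f: "f integrable_on {c..d}"
    by (intro integrable_continuous_real lipschitz_on_continuous_on[OF lip])
  have K: "((\<lambda>x. K * \<bar>x - e\<bar>) has_integral K * (((e - c)\<^sup>2 + (d - e)\<^sup>2) / 2)) {c..d}"
    by (intro has_integral_mult_right has_integral_abs_diff ce ed)
  have "norm (integral {c..d} (\<lambda>x. f x - f e)) \<le> integral {c..d} (\<lambda>x. K * \<bar>x - e\<bar>)"
    using f K lipschitz_onD[OF lip, of _ e] ce ed
    by (intro integral_norm_bound_integral integrable_diff)
       (auto simp: dist_real_def)
  moreover have "integral {c..d} (\<lambda>x. f x - f e) = integral {c..d} f - (d - c) * f e"
    using f ce ed by (subst integral_diff) auto
  ultimately show ?thesis
    unfolding integral_unique[OF K] by simp
qed

lemma Simpson_error_lipschitz: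
  fixes f :: "real \<Rightarrow> real" and a b K :: real
  assumes lip: "K-lipschitz_on {a..b} f" and ab: "a < b"
  shows "\<bar>1 / 6 * (f a + 4 * f ((a + b) / 2) + f b) - 1 / (b - a) * integral {a..b} f\<bar>
    \<le> 5 / 36 * (b - a) * K"
proof -
  define h where "h = b - a"
  \<comment> \<open>The pieces cut off by \<open>u\<close> and \<open>v\<close> have the Simpson
    weights as relative lengths, so Simpson's rule becomes a sum of one-point rules, each with its
    sample point in its own piece.\<close>
  define u where "u = a + h / 6"
  define v where "v = b - h / 6"
  define m where "m = (a + b) / 2"
  have h: "h > 0" and ord: "a \<le> u" "u \<le> m" "m \<le> v" "v \<le> b"
    using ab by (auto simp: h_def u_def v_def m_def field_simps)
  have int: "f integrable_on {a..b}" "f integrable_on {a..v}"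
    using ord by (auto intro!: integrable_continuous_real continuous_on_subset
        [OF lipschitz_on_continuous_on[OF lip]])
  have split: "integral {a..u} f + integral {u..v} f + integral {v..b} f = integral {a..b} f"
    using Henstock_Kurzweil_Integration.integral_combine[OF _ _ int(2), of u]
      Henstock_Kurzweil_Integration.integral_combine[OF _ _ int(1), of v] ord by simp
  have "\<bar>integral {a..u} f - (u - a) * f a\<bar> \<le> K * (((a - a)\<^sup>2 + (u - a)\<^sup>2) / 2)"
    and "\<bar>integral {u..v} f - (v - u) * f m\<bar> \<le> K * (((m - u)\<^sup>2 + (v - m)\<^sup>2) / 2)"
    and "\<bar>integral {v..b} f - (b - v) * f b\<bar> \<le> K * (((b - v)\<^sup>2 + (b - b)\<^sup>2) / 2)"
    using ord by (intro Ostrowski_inequality lipschitz_on_subset[OF lip]; simp)+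
  moreover have "u - a = h / 6" "v - u = 4 * h / 6" "b - v = h / 6" "m - u = h / 3" "v - m = h / 3"
    by (auto simp: h_def u_def v_def m_def field_simps)
  \<comment> \<open>The three bounds are \<open>K * h\<^sup>2\<close> times 1/72, 8/72 and 1/72,
    with sum 5/36.\<close>
  ultimately have "\<bar>h / 6 * (f a + 4 * f m + f b) - integral {a..b} f\<bar> \<le> 5 / 36 * h\<^sup>2 * K"
    unfolding split[symmetric] power2_eq_square by (simp only: abs_le_iff) (simp add: algebra_simps)
  then have "\<bar>(h / 6 * (f a + 4 * f m + f b) - integral {a..b} f) / h\<bar> \<le> 5 / 36 * h\<^sup>2 * K / h"
    unfolding abs_divide abs_of_pos[OF h] using h by (intro divide_right_mono) auto
  moreover have "(h / 6 * (f a + 4 * f m + f b) - integral {a..b} f) / h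
      = 1 / 6 * (f a + 4 * f m + f b) - 1 / h * integral {a..b} f"
    and "5 / 36 * h\<^sup>2 * K / h = 5 / 36 * h * K"
    using h by (simp_all add: field_simps power2_eq_square)
  ultimately show ?thesis
    unfolding h_def m_def by (simp only:)
qed

text \<open>The bound 5/6 is the value of the right-hand side at \<open>p = 1\<close>.\<close>

lemma Simpson_constant_ge:
  fixes p :: real
  assumes p: "p \<ge> 1"
  shows "5 / 6 \<le> ((1 + 2 powr (p + 1)) / (3 * (p + 1))) powr (1 / p)"
proof -
  \<comment> \<open>The bases 6/5 and 12/5 turn into 1 and 2 after scaling by 5/6. Adding the first
    bound to twice the second gives exactly \<open>3 * (p + 1)\<close> on the left.\<close>
  have "1 + p * (1 / 5) \<le> (6 / 5) powr p" "1 + p * (7 / 5) \<le> (12 / 5) powr p"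
    using Bernoulli_inequality_powr[of "1 / 5" p] Bernoulli_inequality_powr[of "7 / 5" p] p
    by simp_all
  then have "3 * (p + 1) \<le> (6 / 5) powr p + 2 * (12 / 5) powr p"
    by simp
  then have "(5 / 6) powr p * (3 * (p + 1)) \<le> (5 / 6) powr p * ((6 / 5) powr p + 2 * (12 / 5) powr p)"
    by (rule mult_left_mono) simp
  also have "\<dots> = 1 + 2 powr (p + 1)"
    by (simp add: distrib_left powr_mult[symmetric] powr_add)
  finally have "(5 / 6) powr p \<le> (1 + 2 powr (p + 1)) / (3 * (p + 1))"
    using p by (simp add: pos_le_divide_eq)
  then have "((5 / 6) powr p) powr (1 / p) \<le> ((1 + 2 powr (p + 1)) / (3 * (p + 1))) powr (1 / p)"
    using p by (intro powr_mono2) auto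
  then show ?thesis
    using p by (simp add: powr_powr)
qed

lemma quasi_convex_on_le_Sup_endpoints:
  fixes a b x :: real
  assumes "quasi_convex_on {a..b} g" "x \<in> {a..b}"
  shows "g x \<le> Sup {g a, g b}"
proof (cases "a = b")
  case False
  define t where "t = (b - x) / (b - a)"
  have "t \<in> {0..1}" and tx: "t * (b - a) = b - x"
    using assms(2) False by (auto simp: t_def field_simps)
  moreover have "x = t * a + (1 - t) * b"
    using tx by (simp add: algebra_simps)
  ultimately show ?thesis
    using assms unfolding quasi_convex_on_def by auto
qed (use assms in auto)

theorem corollary5:
  fixes I :: "real set" and f :: "real \<Rightarrow> real" and a b p q :: real
  assumes "is_interval I"
    and "f differentiable_on interior I"
    and "a \<in> interior I" and "b \<in> interior I" and "a < b"
    and "deriv f absolutely_integrable_on {a..b}"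
    and "q > 1" and "1 / p + 1 / q = 1"
    and "quasi_convex_on {a..b} (\<lambda>x. \<bar>deriv f x\<bar> powr q)"
  shows "\<bar>1 / 6 * (f a + 4 * f ((a + b) / 2) + f b) - 1 / (b - a) * integral {a..b} f\<bar>
    \<le> (b - a) / 6 * ((1 + 2 powr (p + 1)) / (3 * (p + 1))) powr (1 / p)
       * (Sup {\<bar>deriv f a\<bar> powr q, \<bar>deriv f b\<bar> powr q}) powr (1 / q)"
proof -
  define M where "M = (Sup {\<bar>deriv f a\<bar> powr q, \<bar>deriv f b\<bar> powr q}) powr (1 / q)"
  define C where "C = ((1 + 2 powr (p + 1)) / (3 * (p + 1))) powr (1 / p)"
  \<comment> \<open>The sign of \<open>p\<close> is not assumed: conjugacy with \<open>q > 1\<close>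
    puts \<open>1 / p\<close> strictly between 0 and 1.\<close>
  have p: "p \<ge> 1"
  proof -
    have "1 / p = 1 - 1 / q" "1 / q < 1" "0 < 1 / q"
      using assms(7,8) by auto
    then have "0 < 1 / p" "1 / p \<le> 1" by linarith+
    then show ?thesis by (simp add: field_simps)
  qed
  have bound: "\<bar>deriv f x\<bar> \<le> M" if "x \<in> {a..b}" for x
  proof -
    have "(\<bar>deriv f x\<bar> powr q) powr (1 / q) \<le> M"
      unfolding M_def using quasi_convex_on_le_Sup_endpoints[OF assms(9) that] assms(7)
      by (intro powr_mono2) auto
    then show ?thesis
      using assms(7) by (simp add: powr_powr)
  qed
  \<comment> \<open>Since \<open>{a..b}\<close> lies in the open set \<open>interior I\<close>,
    \<open>deriv f\<close> is a genuine two-sided derivative even at \<open>a\<close> and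
    \<open>b\<close>.\<close>
  have "is_interval (interior I)"
    using assms(1) by (simp add: is_interval_convex_1)
  then have sub: "x \<in> interior I" if "x \<in> {a..b}" for x
    by (rule mem_is_interval_1_I[OF _ assms(3,4)]) (use that in auto)
  have "(f has_real_derivative deriv f x) (at x)" if "x \<in> {a..b}" for x
    using assms(2) sub[OF that] at_within_open[OF sub[OF that] open_interior]
    by (auto simp: differentiable_on_def DERIV_deriv_iff_real_differentiable)
  \<comment> \<open>Mean value inequality on the convex set \<open>{a..b}\<close>.\<close>
  then have "norm (f x - f y) \<le> M * norm (x - y)" if "x \<in> {a..b}" "y \<in> {a..b}" for x y
    using bound that
    by (intro field_differentiable_bound[of "{a..b}" f "deriv f"])
       (auto intro: has_field_derivative_at_within)
  then have "M-lipschitz_on {a..b} f"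
    by (intro lipschitz_onI) (auto simp: dist_norm M_def)
  then have "\<bar>1 / 6 * (f a + 4 * f ((a + b) / 2) + f b) - 1 / (b - a) * integral {a..b} f\<bar>
      \<le> 5 / 36 * (b - a) * M"
    using assms(5) by (rule Simpson_error_lipschitz)
  \<comment> \<open>Splitting off the factor 1/6 leaves 5/6 to be compared with
    \<open>C\<close>.\<close>
  also have "\<dots> = (b - a) / 6 * (5 / 6) * M"
    by simp
  also have "\<dots> \<le> (b - a) / 6 * C * M"
    using Simpson_constant_ge[OF p] assms(5)
    by (intro mult_right_mono mult_left_mono) (auto simp: C_def M_def)
  finally show ?thesis
    unfolding C_def M_def .
qed

end
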